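(* Let $c<d$ be real numbers and let $\alpha,\beta,\gamma_1,\gamma_2,\delta_1,\delta_2,\omega_1,\omega_2\in\mathbb{C}$ with $\mathrm{Re}(\alpha)>0$, $\mathrm{Re}(\beta)>0$, $\mathrm{Re}(\gamma_1)>0$, $\mathrm{Re}(\gamma_2)>0$. For any $f\in L^1(c,d)$, $$\left({}_c\mathfrak{I}_{\alpha,\beta,\gamma_1}^{\delta_1;\omega_1,\omega_2}\,{}_c\mathfrak{I}_{\alpha,\beta,\gamma_2}^{\delta_2;\omega_1,\omega_2}f\right)(x)=\left({}_c\mathfrak{I}_{\alpha,\beta,\gamma_1+\gamma_2}^{\delta_1+\delta_2;\omega_1,\omega_2}f\right)(x).$$ In particular, for any $\delta\in\mathbb{C}$, $$\left({}_c\mathfrak{I}_{\alpha,\beta,\gamma_1}^{\delta;\omega_1,\omega_2}\,{}_c\mathfrak{I}_{\alpha,\beta,\gamma_2}^{-\delta;\omega_1,\omega_2}f\right)(x)={}^{RL}_{\ \,c}I_x^{\gamma_1+\gamma_2}f(x).$$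
   Context: For $\alpha,\beta,\gamma,\delta\in\mathbb{C}$ with $\mathrm{Re}(\alpha)>0$, $\mathrm{Re}(\beta)>0$ and $x,y\in\mathbb{C}$, the bivariate Mittag-Leffler function is $$E_{\alpha,\beta,\gamma}^{\delta}(x,y)=\sum_{k=0}^{\infty}\sum_{l=0}^{\infty}\frac{(\delta)_{k+l}}{\Gamma(\alpha k+\beta l+\gamma)}\cdot\frac{x^ky^l}{k!\,l!}$$ (the double series converges absolutely), where $(a)_n=a(a+1)\cdots(a+n-1)$, $(a)_0=1$, is the Pochhammer symbol. For $\mathrm{Re}(\alpha),\mathrm{Re}(\beta),\mathrm{Re}(\gamma)>0$ and $f\in L^1(c,d)$, the associated fractional integral operator (which maps $L^1(c,d)$ to itself) is $$\Big({}_c\mathfrak{I}_{\alpha,\beta,\gamma}^{\delta;\omega_1,\omega_2}f\Big)(x)=\int_c^x(x-\xi)^{\gamma-1}E_{\alpha,\beta,\gamma}^{\delta}\left(\omega_1(x-\xi)^{\alpha},\omega_2(x-\xi)^{\beta}\right)f(\xi)\,\mathrm{d}\xi.$$ For $\mathrm{Re}(\nu)>0$ the Riemann--Liouville integral is ${}^{RL}_{\ \,c}I_{x}^{\nu}f(x)=\frac{1}{\Gamma(\nu)}\int_c^x(x-\xi)^{\nu-1}f(\xi)\,\mathrm{d}\xi$. Complex powers of positive reals are principal; identities between $L^1$ functions are understood for almost every $x\in(c,d)$. *)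

theory Defs
  imports "HOL-Analysis.Analysis"
begin

text \<open>At the poles of \<open>Gamma\<close> the library sets \<open>Gamma z = 0\<close>, and division by zero yields zero, so the
  quotient below agrees with the usual convention that the entire function \<open>1 / \<Gamma>\<close> vanishes at the
  non-positive integers.\<close>

definition mittag_leffler2 ::
    "complex \<Rightarrow> complex \<Rightarrow> complex \<Rightarrow> complex \<Rightarrow> complex \<Rightarrow> complex \<Rightarrow> complex" where
  "mittag_leffler2 \<alpha> \<beta> \<gamma> \<delta> x y =
     (\<Sum>k. \<Sum>l. pochhammer \<delta> (k + l) / Gamma (\<alpha> * of_nat k + \<beta> * of_nat l + \<gamma>)
              * (x ^ k * y ^ l / (fact k * fact l)))"

text \<open>The complex \<open>powr\<close> is the principal power. Elements of \<open>L\<^sup>1(c,d)\<close> are represented by functions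
  on the reals, whose values outside \<open>(c,d)\<close> are not used for \<open>x \<in> (c,d)\<close>.\<close>

definition ml_integral ::
    "real \<Rightarrow> complex \<Rightarrow> complex \<Rightarrow> complex \<Rightarrow> complex \<Rightarrow> complex \<Rightarrow> complex
      \<Rightarrow> (real \<Rightarrow> complex) \<Rightarrow> real \<Rightarrow> complex" where
  "ml_integral c \<alpha> \<beta> \<gamma> \<delta> \<omega>1 \<omega>2 f x =
     (LINT \<xi>:{c<..<x}|lebesgue.
        complex_of_real (x - \<xi>) powr (\<gamma> - 1)
        * mittag_leffler2 \<alpha> \<beta> \<gamma> \<delta>
            (\<omega>1 * complex_of_real (x - \<xi>) powr \<alpha>) (\<omega>2 * complex_of_real (x - \<xi>) powr \<beta>)
        * f \<xi>)"

definition RL_integral :: "real \<Rightarrow> complex \<Rightarrow> (real \<Rightarrow> complex) \<Rightarrow> real \<Rightarrow> complex" where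
  "RL_integral c \<nu> f x =
     1 / Gamma \<nu> * (LINT \<xi>:{c<..<x}|lebesgue. complex_of_real (x - \<xi>) powr (\<nu> - 1) * f \<xi>)"

end

theory Submission
  imports Defs
begin

text \<open>The operators are convolutions. For \<open>t > 0\<close> put \<open>P z t = t powr (z - 1) / Gamma z\<close>, extended by \<open>0\<close>;
convolution with \<open>P z\<close> is the Riemann--Liouville integral of order \<open>z\<close>, and \<open>P a * P b = P (a + b)\<close> by
Euler's Beta integral. Inserting the double series of the Mittag-Leffler function shows that the kernel
of the operator with parameters \<open>\<gamma>\<close> and \<open>\<delta>\<close> is
\<open>K \<gamma> \<delta> = (\<Sum>k l. pochhammer \<delta> (k + l) * \<omega>1 ^ k * \<omega>2 ^ l / (k! l!) * P (\<alpha> k + \<beta> l + \<gamma>))\<close>. Multiplying two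
such series term by term, the exponents add, and the coefficients of equal index combine to those for
\<open>\<delta>1 + \<delta>2\<close> by a Vandermonde identity (\<open>ml_coeff_convolution\<close>). Hence
\<open>K \<gamma>1 \<delta>1 * K \<gamma>2 \<delta>2 = K (\<gamma>1 + \<gamma>2) (\<delta>1 + \<delta>2)\<close>, and the composition rule is the associativity of
convolution. For \<open>\<delta> = 0\<close> only the term \<open>k = l = 0\<close> survives, which gives the Riemann--Liouville integral.

All convergence questions are answered in \<open>L\<^sup>1\<close> of the real line. Multiplying every function by
\<open>exp (- \<mu> t)\<close> respects convolution and makes the kernels integrable. The norms \<open>N \<mu> z\<close> of the damped
\<open>P z\<close> satisfy \<open>N \<mu> (a + b) \<le> N \<mu> a * N \<mu> b\<close>, because the norm of a convolution is at most the product of the norms,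
and they tend to \<open>0\<close> as \<open>\<mu>\<close> grows. So for large \<open>\<mu>\<close> the series is dominated by a product of two
convergent geometric series (\<open>eventually_RL_summable_ml\<close>). The same norms bound the terms at each point
(\<open>RL_kernel_le_RL_norm\<close>), so that the iterated series defining the Mittag-Leffler function is an absolutely convergent sum over pairs.\<close>

\<comment> \<open>Two notions of absolute summability share one infix; the one defined by integration over a counting
  measure is meant throughout.\<close>
no_notation Infinite_Sum.abs_summable_on (infixr \<open>abs'_summable'_on\<close> 46)

section \<open>Convolution on the real line\<close>

definition conv :: "(real \<Rightarrow> complex) \<Rightarrow> (real \<Rightarrow> complex) \<Rightarrow> real \<Rightarrow> complex" where
  "conv f g x = (LINT y|lborel. f (x - y) * g y)"

lemma
  fixes f :: "real \<Rightarrow> 'a::{banach,second_countable_topology}"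
  shows integral_lborel_translate: "(LINT x|lborel. f (x - a)) = integral\<^sup>L lborel f"
    and integrable_lborel_translate: "integrable lborel f \<Longrightarrow> integrable lborel (\<lambda>x. f (x - a))"
  using lborel_integral_real_affine[of 1 f "-a"] lborel_integrable_real_affine[of f 1 "-a"]
  by (simp_all add: algebra_simps)

lemma integral_lborel_reflect:
  fixes f :: "real \<Rightarrow> 'a::{banach,second_countable_topology}"
  shows "(LINT y|lborel. f (a - y)) = integral\<^sup>L lborel f"
  using lborel_integral_real_affine[of "-1" f a] by simp

text \<open>Translates of an integrable function, weighted by an integrable function of the shift, are jointly
integrable, since every translate has the same norm. The shift is read off an arbitrary measure space
by \<open>u\<close>: \<open>lborel\<close> itself gives the convolution of two functions, a plane gives triple convolutions, and
the product of a counting measure with \<open>lborel\<close> gives the convolution with a series.\<close>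
lemma integrable_translates:
  fixes f :: "real \<Rightarrow> complex" and H :: "'a \<Rightarrow> complex"
  assumes M: "sigma_finite_measure M" and H: "integrable M H"
    and u[measurable]: "u \<in> borel_measurable M" and f: "integrable lborel f"
  shows "integrable (M \<Otimes>\<^sub>M lborel) (\<lambda>(p, x). f (x - u p) * H p)"
proof -
  interpret M: sigma_finite_measure M by fact
  interpret pair_sigma_finite M lborel ..
  have [measurable]: "f \<in> borel_measurable borel" "H \<in> borel_measurable M"
    using f H by (auto dest: borel_measurable_integrable)
  show ?thesis
  proof (rule Fubini_integrable)
    have "(LINT x|lborel. norm (f (x - u p) * H p)) = integral\<^sup>L lborel (\<lambda>x. norm (f x)) * norm (H p)" for p
      using integral_lborel_translate[of "\<lambda>x. norm (f x)" "u p"] by (simp add: norm_mult)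
    then show "integrable M (\<lambda>p. LINT x|lborel. norm (case (p, x) of (p, x) \<Rightarrow> f (x - u p) * H p))"
      using H by simp
    show "AE p in M. integrable lborel (\<lambda>x. case (p, x) of (p, x) \<Rightarrow> f (x - u p) * H p)"
      using integrable_lborel_translate[OF f] by simp
  qed measurable
qed

lemma
  assumes f: "integrable lborel f" and g: "integrable lborel g"
  shows conv_integrable: "integrable lborel (conv f g)"
    and conv_integral: "integral\<^sup>L lborel (conv f g) = integral\<^sup>L lborel f * integral\<^sup>L lborel g"
proof -
  have I: "integrable (lborel \<Otimes>\<^sub>M lborel) (\<lambda>(y, x). f (x - y) * g y)"
    using integrable_translates[OF _ g _ f, of "\<lambda>y. y"] by (simp add: lborel.sigma_finite_measure_axioms)
  show "integrable lborel (conv f g)"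
    using lborel_pair.integrable_snd[OF I] by (simp add: conv_def[abs_def])
  show "integral\<^sup>L lborel (conv f g) = integral\<^sup>L lborel f * integral\<^sup>L lborel g"
    using lborel_pair.Fubini_integral[OF I] by (simp add: conv_def[abs_def] integral_lborel_translate)
qed

text \<open>The triangle inequality bounds \<open>conv f g\<close> by the convolution of the two moduli, and the integral of
that convolution is the product of the two norms.\<close>
lemma conv_norm_le:
  assumes f: "integrable lborel f" and g: "integrable lborel g"
  shows "(LINT x|lborel. norm (conv f g x)) \<le> (LINT x|lborel. norm (f x)) * (LINT x|lborel. norm (g x))"
proof -
  let ?f = "\<lambda>x. complex_of_real (norm (f x))" and ?g = "\<lambda>x. complex_of_real (norm (g x))"
  have fg: "integrable lborel ?f" "integrable lborel ?g" using f g by auto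
  have eq: "conv ?f ?g x = of_real (LINT y|lborel. norm (f (x - y) * g y))" for x
    unfolding conv_def by (simp add: norm_mult flip: of_real_mult)
  have "integrable lborel (\<lambda>x. Re (conv ?f ?g x))"
    by (intro integrable_Re conv_integrable fg)
  then have I: "integrable lborel (\<lambda>x. LINT y|lborel. norm (f (x - y) * g y))"
    by (simp add: eq)
  have "(LINT x|lborel. norm (conv f g x)) \<le> (LINT x|lborel. LINT y|lborel. norm (f (x - y) * g y))"
    by (intro integral_mono integrable_norm conv_integrable f g I) (simp add: conv_def integral_norm_bound)
  moreover have "complex_of_real (LINT x|lborel. LINT y|lborel. norm (f (x - y) * g y)) =
      of_real ((LINT x|lborel. norm (f x)) * (LINT x|lborel. norm (g x)))"
    using conv_integral[OF fg] by (simp add: eq[abs_def])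
  ultimately show ?thesis by (simp only: of_real_eq_iff)
qed

lemma conv_commute: "conv f g = conv g f"
proof
  fix x show "conv f g x = conv g f x"
    using integral_lborel_reflect[of "\<lambda>y. f y * g (x - y)" x] by (simp add: conv_def mult.commute)
qed

lemma conv_AE_cong:
  assumes [measurable]: "f \<in> borel_measurable borel" "f' \<in> borel_measurable borel" "g \<in> borel_measurable borel"
    and ae: "AE x in lborel. f x = f' x"
  shows "conv f g x = conv f' g x"
  unfolding conv_def
proof (rule integral_cong_AE)
  have "AE y in lborel. f (x + (-1) * y) = f' (x + (-1) * y)"
    by (rule AE_borel_affine[OF _ _ ae]) auto
  then show "AE y in lborel. f (x - y) * g y = f' (x - y) * g y" by auto
qed auto

text \<open>Interchanging the two integrals is allowed at those \<open>x\<close> for which the double integrand is integrable,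
hence almost everywhere only.\<close>
lemma conv_assoc_AE:
  assumes f: "integrable lborel f" and g: "integrable lborel g" and h: "integrable lborel h"
  shows "AE x in lborel. conv f (conv g h) x = conv (conv f g) h x"
proof -
  let ?L2 = "lborel \<Otimes>\<^sub>M (lborel :: real measure)"
  interpret M: pair_sigma_finite ?L2 "lborel :: real measure"
    by (simp add: lborel_pair.P.sigma_finite_measure_axioms lborel.sigma_finite_measure_axioms pair_sigma_finite_def)
  have "integrable ?L2 (\<lambda>(z, y). g (y - z) * h z)"
    using integrable_translates[OF _ h _ g, of "\<lambda>y. y"] by (simp add: lborel.sigma_finite_measure_axioms)
  then have "integrable (?L2 \<Otimes>\<^sub>M lborel) (\<lambda>(p, x). f (x - snd p) * (case p of (z, y) \<Rightarrow> g (y - z) * h z))"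
    by (rule integrable_translates[OF lborel_pair.P.sigma_finite_measure_axioms _ _ f]) auto
  then have "AE x in lborel. integrable ?L2 (\<lambda>p. f (x - snd p) * (case p of (z, y) \<Rightarrow> g (y - z) * h z))"
    by (rule M.AE_integrable_snd)
  then show ?thesis
  proof eventually_elim
    case (elim x)
    then have "integrable ?L2 (\<lambda>(z, y). f (x - y) * (g (y - z) * h z))"
      by (simp add: case_prod_unfold)
    from lborel_pair.Fubini_integral[OF this]
    have "conv f (conv g h) x = (LINT z|lborel. (LINT y|lborel. f (x - y) * g (y - z)) * h z)"
      by (simp add: conv_def mult.assoc flip: integral_mult_left_zero)
    also have "\<dots> = (LINT z|lborel. conv f g (x - z) * h z)"
    proof -
      have "(LINT y|lborel. f (x - y) * g (y - z)) = conv f g (x - z)" for z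
        using integral_lborel_translate[of "\<lambda>y. f (x - z - y) * g y" z] by (simp add: conv_def)
      then show ?thesis by simp
    qed
    finally show ?case by (simp add: conv_def)
  qed
qed

section \<open>Riemann--Liouville kernels\<close>

text \<open>Convolution with \<open>RL_kernel z\<close> is Riemann--Liouville integration of order \<open>z\<close> started at the left end
of the support.\<close>
definition RL_kernel :: "complex \<Rightarrow> real \<Rightarrow> complex" where
  "RL_kernel z t = (if t > 0 then of_real t powr (z - 1) / Gamma z else 0)"

text \<open>The kernels are not integrable at infinity. An exponential factor makes them so, and it is
compatible with convolution because \<open>exp\<close> turns \<open>x = (x - y) + y\<close> into a product.\<close>
definition damp :: "real \<Rightarrow> (real \<Rightarrow> complex) \<Rightarrow> real \<Rightarrow> complex" where
  "damp \<mu> f t = of_real (exp (- \<mu> * t)) * f t"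

definition RL_norm :: "real \<Rightarrow> complex \<Rightarrow> real" where
  "RL_norm \<mu> z = (LINT t|lborel. norm (damp \<mu> (RL_kernel z) t))"

lemma measurable_RL_kernel [measurable]: "RL_kernel z \<in> borel_measurable borel"
proof -
  have "RL_kernel z = (\<lambda>t. if t > 0 then exp ((z - 1) * of_real (ln t)) / Gamma z else 0)"
    by (auto simp: RL_kernel_def powr_def Ln_of_real fun_eq_iff)
  then show ?thesis by simp
qed

lemma measurable_damp [measurable]: "f \<in> borel_measurable borel \<Longrightarrow> damp \<mu> f \<in> borel_measurable borel"
  unfolding damp_def[abs_def] by measurable

lemma conv_damp: "conv (damp \<mu> f) (damp \<mu> g) x = damp \<mu> (conv f g) x"
proof -
  have "damp \<mu> f (x - y) * damp \<mu> g y = of_real (exp (- \<mu> * x)) * (f (x - y) * g y)" for y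
  proof -
    have "exp (- \<mu> * x) = exp (- \<mu> * (x - y)) * exp (- \<mu> * y)"
      by (simp add: algebra_simps flip: exp_add)
    then show ?thesis by (simp add: damp_def mult_ac)
  qed
  then show ?thesis unfolding conv_def by (simp only:) (simp add: damp_def)
qed

lemma Gamma_nonzero: "Re z > 0 \<Longrightarrow> Gamma z \<noteq> (0 :: complex)"
  by (auto simp: Gamma_eq_zero_iff elim!: nonpos_Ints_cases)

lemma damp_RL_kernel_eq:
  assumes "Re z > 0"
  shows "indicator {0<..} t *\<^sub>R (of_real t powr (z - 1) / of_real (exp (\<mu> * t)))
    = Gamma z * damp \<mu> (RL_kernel z) t"
  using Gamma_nonzero[OF assms] by (simp add: damp_def RL_kernel_def exp_minus field_simps)

lemma integrable_damp_RL_kernel: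
  assumes "Re z > 0" "\<mu> > 0"
  shows "integrable lborel (damp \<mu> (RL_kernel z))"
proof -
  have "set_integrable lebesgue {0<..} (\<lambda>t. complex_of_real t powr (z - 1) / of_real (exp (\<mu> * t)))"
    by (rule absolutely_integrable_Gamma_integral[OF assms])
  then have "integrable lborel (\<lambda>t. Gamma z * damp \<mu> (RL_kernel z) t)"
    unfolding set_integrable_def damp_RL_kernel_eq[OF assms(1)] by (subst (asm) integrable_completion) auto
  then show ?thesis
    using integrable_mult_right[of "inverse (Gamma z)" lborel "\<lambda>t. Gamma z * damp \<mu> (RL_kernel z) t"]
      Gamma_nonzero[OF assms(1)] by (simp flip: mult.assoc)
qed

lemma integral_damp_RL_kernel:
  assumes "Re z > 0"
  shows "integral\<^sup>L lborel (damp 1 (RL_kernel z)) = 1"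
proof -
  let ?h = "\<lambda>t. complex_of_real t powr (z - 1) / of_real (exp t)"
  have "(LINT t:{0<..}|lebesgue. ?h t) = Gamma z"
    using absolutely_integrable_Gamma_integral'[OF assms] Gamma_integral_complex'[OF assms]
    by (simp add: integral_unique set_lebesgue_integral_eq_integral)
  also have "(LINT t:{0<..}|lebesgue. ?h t) = (LINT t|lborel. Gamma z * damp 1 (RL_kernel z) t)"
    unfolding set_lebesgue_integral_def using damp_RL_kernel_eq[OF assms, of _ 1]
    by (simp add: integral_completion)
  finally show ?thesis
    using Gamma_nonzero[OF assms] by simp
qed

lemma of_real_powr_mult:
  "s > 0 \<Longrightarrow> t > 0 \<Longrightarrow> complex_of_real (s * t) powr z = of_real s powr z * of_real t powr z"
  by (simp add: powr_def ln_mult Ln_of_real algebra_simps exp_add flip: of_real_mult)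

text \<open>This is Euler's Beta integral with complex parameters. Substituting \<open>y = t * s\<close> shows that the
convolution is a constant multiple of \<open>t powr (a + b - 1)\<close>. The constant comes from integrating over
the whole line: after damping with rate 1 every kernel has integral 1, by the definition of \<open>Gamma\<close>,
and integrals multiply under convolution.\<close>
lemma conv_RL_kernel:
  assumes a: "Re a > 0" and b: "Re b > 0"
  shows "conv (RL_kernel a) (RL_kernel b) = RL_kernel (a + b)"
proof -
  define C where "C = Gamma (a + b) * conv (RL_kernel a) (RL_kernel b) 1"
  have ab: "Re (a + b) > 0" using a b by simp
  have C: "conv (RL_kernel a) (RL_kernel b) t = C * RL_kernel (a + b) t" for t
  proof (cases "t > 0")
    case False
    then have "RL_kernel a (t - y) * RL_kernel b y = 0" for y by (auto simp: RL_kernel_def)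
    then show ?thesis using False by (simp only: conv_def) (simp add: RL_kernel_def)
  next
    case True
    have scale: "RL_kernel a (t - t * s) * RL_kernel b (t * s) =
      of_real t powr (a + b - 2) * (RL_kernel a (1 - s) * RL_kernel b s)" for s
    proof (cases "0 < s \<and> s < 1")
      case False
      then show ?thesis using True by (auto simp: RL_kernel_def zero_less_mult_iff)
    next
      case s: True
      have "t - t * s = t * (1 - s)" by (simp add: algebra_simps)
      moreover have "complex_of_real t powr (a + b - 2) = of_real t powr (a - 1) * of_real t powr (b - 1)"
        using True by (simp add: powr_def flip: exp_add) (simp add: algebra_simps)
      ultimately show ?thesis
        using s True by (simp only: RL_kernel_def of_real_powr_mult zero_less_mult_iff) (simp add: of_real_powr_mult del: of_real_mult of_real_diff)
    qed
    have "conv (RL_kernel a) (RL_kernel b) t =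
        t *\<^sub>R (LINT s|lborel. RL_kernel a (t - t * s) * RL_kernel b (t * s))"
      using lborel_integral_real_affine[of t "\<lambda>y. RL_kernel a (t - y) * RL_kernel b y" 0] True
      by (simp add: conv_def)
    also have "\<dots> = of_real t * of_real t powr (a + b - 2) * conv (RL_kernel a) (RL_kernel b) 1"
      by (simp add: scale conv_def scaleR_conv_of_real)
    also have "of_real t * complex_of_real t powr (a + b - 2) = of_real t powr (a + b - 1)"
      using True powr_add[of "complex_of_real t" 1 "a + b - 2"] by (simp add: algebra_simps)
    finally show ?thesis
      using True Gamma_nonzero[OF ab] by (simp add: RL_kernel_def[of "a + b"] C_def)
  qed
  have "damp 1 (conv (RL_kernel a) (RL_kernel b)) = (\<lambda>t. C * damp 1 (RL_kernel (a + b)) t)"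
    by (simp add: damp_def C fun_eq_iff)
  moreover have "conv (damp 1 (RL_kernel a)) (damp 1 (RL_kernel b)) = damp 1 (conv (RL_kernel a) (RL_kernel b))"
    by (simp add: conv_damp fun_eq_iff)
  moreover have "integral\<^sup>L lborel (conv (damp 1 (RL_kernel a)) (damp 1 (RL_kernel b))) = 1"
    by (simp add: conv_integral integrable_damp_RL_kernel integral_damp_RL_kernel a b)
  ultimately have "C = 1"
    using integral_damp_RL_kernel[OF ab] by simp
  then show ?thesis using C by (simp add: fun_eq_iff)
qed

lemma RL_norm_nonneg: "RL_norm \<mu> z \<ge> 0"
  by (simp add: RL_norm_def)

text \<open>For real \<open>z > 0\<close> the norm is \<open>\<mu> powr (- z)\<close>; for complex \<open>z\<close> it also carries the quotient of
\<open>Gamma (Re z)\<close> and \<open>norm (Gamma z)\<close>. Submultiplicativity shows that this quotient grows at most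
geometrically along the exponents \<open>\<alpha> k + \<beta> l + \<gamma>\<close>.\<close>
lemma RL_norm_add:
  assumes "Re a > 0" "Re b > 0" "\<mu> > 0"
  shows "RL_norm \<mu> (a + b) \<le> RL_norm \<mu> a * RL_norm \<mu> b"
  using conv_norm_le[of "damp \<mu> (RL_kernel a)" "damp \<mu> (RL_kernel b)"] assms
  by (simp add: RL_norm_def integrable_damp_RL_kernel conv_damp conv_RL_kernel damp_def)

lemma norm_RL_kernel: "t > 0 \<Longrightarrow> norm (RL_kernel z t) = t powr (Re z - 1) / norm (Gamma z)"
  by (simp add: RL_kernel_def norm_divide norm_powr_real_powr)

lemma RL_norm_scale:
  assumes "\<mu> > 0"
  shows "RL_norm \<mu> z = \<mu> powr (- Re z) * RL_norm 1 z"
proof -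
  have *: "norm (damp 1 (RL_kernel z) (\<mu> * t)) = \<mu> powr (Re z - 1) * norm (damp \<mu> (RL_kernel z) t)" for t
  proof (cases "t > 0")
    case True
    then show ?thesis using assms
      by (simp add: damp_def norm_mult norm_RL_kernel powr_mult)
  next
    case False
    then show ?thesis using assms by (auto simp: damp_def RL_kernel_def zero_less_mult_iff)
  qed
  have "RL_norm 1 z = \<mu> * (\<mu> powr (Re z - 1) * RL_norm \<mu> z)"
    using lborel_integral_real_affine[of \<mu> "\<lambda>t. norm (damp 1 (RL_kernel z) t)" 0] assms
    by (simp add: RL_norm_def *)
  then show ?thesis
    using assms by (simp add: powr_diff powr_minus field_simps)
qed

lemma RL_norm_tendsto_0:
  assumes "Re z > 0"
  shows "((\<lambda>\<mu>. RL_norm \<mu> z) \<longlongrightarrow> 0) at_top"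
proof -
  have "((\<lambda>\<mu>::real. \<mu> powr (- Re z) * RL_norm 1 z) \<longlongrightarrow> 0 * RL_norm 1 z) at_top"
    using assms by (intro tendsto_mult tendsto_neg_powr filterlim_ident tendsto_const) auto
  moreover have "eventually (\<lambda>\<mu>. \<mu> powr (- Re z) * RL_norm 1 z = RL_norm \<mu> z) at_top"
    using eventually_gt_at_top[of 0] by eventually_elim (simp add: RL_norm_scale[symmetric])
  ultimately show ?thesis by (simp add: filterlim_cong)
qed

text \<open>Since \<open>s * norm (RL_kernel z s)\<close> increases with \<open>s\<close>, the value at \<open>t\<close> is controlled by the integral
over \<open>{t..t+1}\<close>. The factor does not depend on \<open>z\<close>, so summability of norms implies pointwise summability
at every \<open>t\<close>.\<close>
lemma RL_kernel_le_RL_norm: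
  assumes "Re z > 0" "\<mu> > 0" "t > 0"
  shows "norm (RL_kernel z t) \<le> (t + 1) / t * exp (\<mu> * (t + 1)) * RL_norm \<mu> z"
proof -
  define m where "m = norm (RL_kernel z t) * (t / (t + 1)) * exp (- \<mu> * (t + 1))"
  have "m = (LINT s|lborel. indicator {t..t+1} s * m)"
    using \<open>t > 0\<close> by simp
  also have "\<dots> \<le> RL_norm \<mu> z"
    unfolding RL_norm_def
  proof (rule integral_mono)
    show "integrable lborel (\<lambda>s. indicator {t..t+1} s * m)"
      by (intro integrable_mult_left integrable_real_indicator) auto
    show "integrable lborel (\<lambda>s. norm (damp \<mu> (RL_kernel z) s))"
      using assms by (intro integrable_norm integrable_damp_RL_kernel)
    fix s
    show "indicator {t..t+1} s * m \<le> norm (damp \<mu> (RL_kernel z) s)"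
    proof (cases "s \<in> {t..t+1}")
      case True
      then have s: "s > 0" "t \<le> s" "s \<le> t + 1" using \<open>t > 0\<close> by auto
      have "norm (RL_kernel z t) * (t / (t + 1)) = t powr Re z / (t + 1) / norm (Gamma z)"
        using \<open>t > 0\<close> by (simp add: norm_RL_kernel powr_diff)
      also have "\<dots> \<le> s powr Re z / s / norm (Gamma z)"
        using s \<open>t > 0\<close> assms by (intro divide_right_mono frac_le powr_mono2) auto
      also have "\<dots> = norm (RL_kernel z s)"
        using s by (simp add: norm_RL_kernel powr_diff)
      finally have "m \<le> norm (RL_kernel z s) * exp (- \<mu> * s)"
        unfolding m_def using s assms by (intro mult_mono) auto
      then show ?thesis using True by (simp add: damp_def norm_mult mult.commute)
    qed simp
  qed
  finally have "m * ((t + 1) / t * exp (\<mu> * (t + 1))) \<le> RL_norm \<mu> z * ((t + 1) / t * exp (\<mu> * (t + 1)))"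
    using \<open>t > 0\<close> by (intro mult_right_mono) auto
  also have "m * ((t + 1) / t * exp (\<mu> * (t + 1))) = norm (RL_kernel z t)"
    using \<open>t > 0\<close> by (simp add: m_def exp_minus)
  finally show ?thesis by (simp add: mult_ac)
qed

section \<open>Series of Riemann--Liouville kernels\<close>

definition RL_series :: "('i \<Rightarrow> complex) \<Rightarrow> ('i \<Rightarrow> complex) \<Rightarrow> real \<Rightarrow> complex" where
  "RL_series c z t = (\<Sum>\<^sub>ai. c i * RL_kernel (z i) t)"

text \<open>The last condition says that the damped series converges absolutely in \<open>L\<^sup>1\<close>.\<close>
definition RL_summable :: "real \<Rightarrow> ('i \<Rightarrow> complex) \<Rightarrow> ('i \<Rightarrow> complex) \<Rightarrow> bool" where
  "RL_summable \<mu> c z \<longleftrightarrow>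
     \<mu> > 0 \<and> (\<forall>i. Re (z i) > 0) \<and> (\<lambda>i. norm (c i) * RL_norm \<mu> (z i)) abs_summable_on UNIV"

lemma RL_series_abs_summable:
  assumes "RL_summable \<mu> c z"
  shows "(\<lambda>i. c i * RL_kernel (z i) t) abs_summable_on UNIV"
proof (cases "t > 0")
  case True
  let ?C = "(t + 1) / t * exp (\<mu> * (t + 1))"
  have "(\<lambda>i. ?C * (norm (c i) * RL_norm \<mu> (z i))) abs_summable_on UNIV"
    using assms unfolding RL_summable_def by (intro abs_summable_on_cmult_right) auto
  then show ?thesis
  proof (rule abs_summable_on_comparison_test')
    fix i
    have "norm (c i) * norm (RL_kernel (z i) t) \<le> norm (c i) * (?C * RL_norm \<mu> (z i))"
      using assms True by (intro mult_left_mono RL_kernel_le_RL_norm) (auto simp: RL_summable_def)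
    then show "norm (c i * RL_kernel (z i) t) \<le> ?C * (norm (c i) * RL_norm \<mu> (z i))"
      by (simp add: norm_mult mult_ac)
  qed
qed (simp add: RL_kernel_def)

lemma damp_RL_series:
  assumes "RL_summable \<mu> c z"
  shows "damp \<mu> (RL_series c z) t = (\<Sum>\<^sub>ai. c i * damp \<mu> (RL_kernel (z i)) t)"
proof -
  have "c i * damp \<mu> (RL_kernel (z i)) t = of_real (exp (- \<mu> * t)) * (c i * RL_kernel (z i) t)" for i
    by (simp add: damp_def mult_ac)
  then have "(\<Sum>\<^sub>ai. c i * damp \<mu> (RL_kernel (z i)) t)
      = of_real (exp (- \<mu> * t)) * (\<Sum>\<^sub>ai. c i * RL_kernel (z i) t)"
    by (simp only: infsetsum_cmult_right[OF RL_series_abs_summable[OF assms]])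
  then show ?thesis
    by (simp add: damp_def RL_series_def)
qed

lemma RL_series_nonpos: "t \<le> 0 \<Longrightarrow> RL_series c z t = 0"
  by (simp add: RL_series_def RL_kernel_def)

lemma integrable_count_space_pair:
  fixes \<phi> :: "'i::countable \<Rightarrow> 'a \<Rightarrow> complex"
  assumes "sigma_finite_measure M"
    and \<phi>: "\<And>i. integrable M (\<phi> i)"
    and sum: "(\<lambda>i. LINT t|M. norm (\<phi> i t)) abs_summable_on UNIV"
  shows "integrable (count_space UNIV \<Otimes>\<^sub>M M) (\<lambda>(i, t). \<phi> i t)"
proof -
  interpret M: sigma_finite_measure M by fact
  interpret C: sigma_finite_measure "count_space (UNIV :: 'i set)"
    by (rule sigma_finite_measure_count_space)
  interpret pair_sigma_finite "count_space (UNIV :: 'i set)" M ..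
  have [measurable]: "\<phi> i \<in> borel_measurable M" for i
    using \<phi> by auto
  show ?thesis
    using \<phi> sum by (intro Fubini_integrable) (auto simp: abs_summable_on_def)
qed

text \<open>The series is an integral over a counting measure, so this is one more application of Fubini's
theorem.\<close>
lemma conv_infsetsum:
  fixes \<phi> :: "'i::countable \<Rightarrow> real \<Rightarrow> complex"
  assumes f: "integrable lborel f" and \<phi>: "\<And>i. integrable lborel (\<phi> i)"
    and sum: "(\<lambda>i. LINT t|lborel. norm (\<phi> i t)) abs_summable_on UNIV"
  shows "integrable lborel (\<lambda>t. \<Sum>\<^sub>ai. \<phi> i t)"
    and "AE x in lborel. conv f (\<lambda>t. \<Sum>\<^sub>ai. \<phi> i t) x = (\<Sum>\<^sub>ai. conv f (\<phi> i) x)"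
proof -
  interpret C: sigma_finite_measure "count_space (UNIV :: 'i set)"
    by (rule sigma_finite_measure_count_space)
  let ?M = "count_space (UNIV :: 'i set) \<Otimes>\<^sub>M (lborel :: real measure)"
  interpret P: pair_sigma_finite "count_space (UNIV :: 'i set)" "lborel :: real measure" ..
  interpret Q: pair_sigma_finite ?M "lborel :: real measure" ..
  have I: "integrable ?M (\<lambda>(i, t). \<phi> i t)"
    by (intro integrable_count_space_pair \<phi> sum lborel.sigma_finite_measure_axioms)
  show "integrable lborel (\<lambda>t. \<Sum>\<^sub>ai. \<phi> i t)"
    using P.integrable_snd[OF I] by (simp add: infsetsum_def)
  have "integrable (?M \<Otimes>\<^sub>M lborel) (\<lambda>(p, x). f (x - snd p) * (case p of (i, t) \<Rightarrow> \<phi> i t))"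
    by (rule integrable_translates[OF P.sigma_finite_measure_axioms I _ f]) simp
  then have "AE x in lborel. integrable ?M (\<lambda>p. f (x - snd p) * (case p of (i, t) \<Rightarrow> \<phi> i t))"
    by (rule Q.AE_integrable_snd)
  then show "AE x in lborel. conv f (\<lambda>t. \<Sum>\<^sub>ai. \<phi> i t) x = (\<Sum>\<^sub>ai. conv f (\<phi> i) x)"
  proof eventually_elim
    case (elim x)
    then have "integrable ?M (\<lambda>(i, y). f (x - y) * \<phi> i y)"
      by (simp add: case_prod_unfold)
    from P.Fubini_integral[OF this] show ?case
      by (simp add: conv_def infsetsum_def)
  qed
qed

lemma
  fixes c z :: "'i::countable \<Rightarrow> complex"
  assumes "RL_summable \<mu> c z"
  shows integrable_damp_RL_series: "integrable lborel (damp \<mu> (RL_series c z))"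
    and conv_damp_RL_series: "integrable lborel f \<Longrightarrow> AE x in lborel.
      conv f (damp \<mu> (RL_series c z)) x = (\<Sum>\<^sub>ai. c i * conv f (damp \<mu> (RL_kernel (z i))) x)"
proof -
  let ?\<phi> = "\<lambda>i t. c i * damp \<mu> (RL_kernel (z i)) t"
  have 1: "integrable lborel (?\<phi> i)" for i
    using assms by (intro integrable_mult_right integrable_damp_RL_kernel) (auto simp: RL_summable_def)
  have 2: "(\<lambda>i. LINT t|lborel. norm (?\<phi> i t)) abs_summable_on UNIV"
    using assms by (simp add: RL_summable_def norm_mult RL_norm_def)
  have 3: "damp \<mu> (RL_series c z) = (\<lambda>t. \<Sum>\<^sub>ai. ?\<phi> i t)"
    using damp_RL_series[OF assms] by (simp add: fun_eq_iff)
  have 4: "conv f (?\<phi> i) x = c i * conv f (damp \<mu> (RL_kernel (z i))) x" for f i x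
    by (simp add: conv_def mult.left_commute[of _ "c i"])
  show "integrable lborel (damp \<mu> (RL_series c z))"
    unfolding 3 by (rule conv_infsetsum(1)[OF 1 1 2])
  show "AE x in lborel.
      conv f (damp \<mu> (RL_series c z)) x = (\<Sum>\<^sub>ai. c i * conv f (damp \<mu> (RL_kernel (z i))) x)"
    if "integrable lborel f"
    using conv_infsetsum(2)[OF that 1 2] unfolding 3 4 .
qed

lemma RL_summable_product:
  fixes c z :: "'i::countable \<Rightarrow> complex" and d w :: "'j::countable \<Rightarrow> complex"
  assumes "RL_summable \<mu> c z" "RL_summable \<mu> d w"
  shows "RL_summable \<mu> (\<lambda>(i, j). c i * d j) (\<lambda>(i, j). z i + w j)"
proof -
  have "(\<lambda>(i, j). (norm (c i) * RL_norm \<mu> (z i)) * (norm (d j) * RL_norm \<mu> (w j)))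
      abs_summable_on UNIV \<times> UNIV"
    using assms by (intro abs_summable_on_product) (auto simp: RL_summable_def)
  then have "(\<lambda>(i, j). norm (c i * d j) * RL_norm \<mu> (z i + w j)) abs_summable_on UNIV \<times> UNIV"
  proof (rule abs_summable_on_comparison_test', safe)
    fix i j
    have "norm (c i * d j) * RL_norm \<mu> (z i + w j)
        \<le> norm (c i * d j) * (RL_norm \<mu> (z i) * RL_norm \<mu> (w j))"
      using assms by (intro mult_left_mono RL_norm_add) (auto simp: RL_summable_def)
    then show "norm (norm (c i * d j) * RL_norm \<mu> (z i + w j))
        \<le> norm (c i) * RL_norm \<mu> (z i) * (norm (d j) * RL_norm \<mu> (w j))"
      by (simp add: norm_mult RL_norm_nonneg mult_ac)
  qed
  then show ?thesis
    using assms by (auto simp: RL_summable_def case_prod_unfold add_pos_pos)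
qed

text \<open>Expanding both factors and using \<open>conv_RL_kernel\<close> in each term gives the double series, first as an
iterated sum. It converges absolutely because the norms are submultiplicative.\<close>
lemma conv_RL_series_AE:
  fixes c z :: "'i::countable \<Rightarrow> complex" and d w :: "'j::countable \<Rightarrow> complex"
  assumes c: "RL_summable \<mu> c z" and d: "RL_summable \<mu> d w"
  shows "AE x in lborel. conv (damp \<mu> (RL_series c z)) (damp \<mu> (RL_series d w)) x
    = damp \<mu> (RL_series (\<lambda>(i, j). c i * d j) (\<lambda>(i, j). z i + w j)) x"
proof -
  let ?S = "damp \<mu> (RL_series c z)" and ?T = "damp \<mu> (RL_series d w)"
  have pos: "\<mu> > 0" "Re (z i) > 0" "Re (w j) > 0" for i j
    using c d by (auto simp: RL_summable_def)
  have T: "AE x in lborel. conv ?T ?S x = (\<Sum>\<^sub>ai. c i * conv ?T (damp \<mu> (RL_kernel (z i))) x)"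
    by (intro conv_damp_RL_series[OF c] integrable_damp_RL_series[OF d])
  have "AE x in lborel. \<forall>i. conv (damp \<mu> (RL_kernel (z i))) ?T x =
      (\<Sum>\<^sub>aj. d j * conv (damp \<mu> (RL_kernel (z i))) (damp \<mu> (RL_kernel (w j))) x)"
    unfolding AE_all_countable
    by (intro allI conv_damp_RL_series[OF d] integrable_damp_RL_kernel pos)
  with T show ?thesis
  proof eventually_elim
    case (elim x)
    have S: "(\<lambda>(i, j). (c i * d j) * damp \<mu> (RL_kernel (z i + w j)) x) abs_summable_on UNIV \<times> UNIV"
      using abs_summable_on_cmult_right[OF RL_series_abs_summable[OF RL_summable_product[OF c d]], of "of_real (exp (- \<mu> * x))" x]
      by (simp add: case_prod_unfold damp_def mult_ac)
    have "conv ?T (damp \<mu> (RL_kernel (z i))) x = (\<Sum>\<^sub>aj. d j * damp \<mu> (RL_kernel (z i + w j)) x)" for i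
      using elim(2) by (simp add: conv_commute[of ?T "damp \<mu> (RL_kernel (z i))"] conv_damp conv_RL_kernel pos)
    then have "conv ?S ?T x = (\<Sum>\<^sub>ai. c i * (\<Sum>\<^sub>aj. d j * damp \<mu> (RL_kernel (z i + w j)) x))"
      using elim(1) by (simp add: conv_commute[of ?S ?T])
    also have "\<dots> = (\<Sum>\<^sub>ai. \<Sum>\<^sub>aj. (c i * d j) * damp \<mu> (RL_kernel (z i + w j)) x)"
    proof (intro infsetsum_cong refl)
      fix i
      have "(\<lambda>j. d j * damp \<mu> (RL_kernel (z i + w j)) x) abs_summable_on UNIV" if "c i \<noteq> 0"
        using abs_summable_on_cmult_right[OF abs_summable_on_Sigma_project2[OF S, of i], of "inverse (c i)"] that
        by (simp flip: mult.assoc)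
      then show "c i * (\<Sum>\<^sub>aj. d j * damp \<mu> (RL_kernel (z i + w j)) x)
          = (\<Sum>\<^sub>aj. (c i * d j) * damp \<mu> (RL_kernel (z i + w j)) x)"
        by (simp add: mult.assoc infsetsum_cmult_right)
    qed
    also have "\<dots> = (\<Sum>\<^sub>a(i, j)\<in>UNIV \<times> UNIV. (c i * d j) * damp \<mu> (RL_kernel (z i + w j)) x)"
      by (rule infsetsum_Times'[OF _ _ S]) auto
    also have "\<dots> = damp \<mu> (RL_series (\<lambda>(i, j). c i * d j) (\<lambda>(i, j). z i + w j)) x"
      using damp_RL_series[OF RL_summable_product[OF c d]] by (simp add: case_prod_unfold)
    finally show ?case .
  qed
qed

section \<open>The bivariate Mittag-Leffler kernel\<close>

text \<open>With these data the kernel \<open>t powr (\<gamma> - 1) * E(\<omega>1 t powr \<alpha>, \<omega>2 t powr \<beta>)\<close> of the operator is a series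
of Riemann--Liouville kernels; see \<open>mittag_leffler2_eq_ml_kernel\<close> below.\<close>
definition ml_coeff :: "complex \<Rightarrow> complex \<Rightarrow> complex \<Rightarrow> nat \<times> nat \<Rightarrow> complex" where
  "ml_coeff \<delta> \<omega>1 \<omega>2 = (\<lambda>(k, l). pochhammer \<delta> (k + l) / (fact k * fact l) * (\<omega>1 ^ k * \<omega>2 ^ l))"

definition ml_exponent :: "complex \<Rightarrow> complex \<Rightarrow> complex \<Rightarrow> nat \<times> nat \<Rightarrow> complex" where
  "ml_exponent \<alpha> \<beta> \<gamma> = (\<lambda>(k, l). \<alpha> * of_nat k + \<beta> * of_nat l + \<gamma>)"

text \<open>Pascal's rule in the form of a step of the binomial transform: raising \<open>l\<close> by one adds the
transform of the shifted sequence. Iterating this step shows below that the transforms for \<open>k\<close> and \<open>l\<close>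
compose to the transform for \<open>k + l\<close>.\<close>
lemma binomial_sum_Suc:
  fixes g :: "nat \<Rightarrow> 'a::comm_semiring_1"
  shows "(\<Sum>j\<le>Suc l. of_nat (Suc l choose j) * g j)
    = (\<Sum>j\<le>l. of_nat (l choose j) * g j) + (\<Sum>j\<le>l. of_nat (l choose j) * g (Suc j))"
proof -
  have "(\<Sum>j\<le>l. of_nat (l choose j) * g j) = (\<Sum>j\<le>Suc l. of_nat (l choose j) * g j)"
    by (simp add: binomial_eq_0)
  also have "\<dots> = g 0 + (\<Sum>j\<le>l. of_nat (l choose Suc j) * g (Suc j))"
    by (subst sum.atMost_Suc_shift) simp
  finally show ?thesis
    by (subst sum.atMost_Suc_shift) (simp add: algebra_simps sum.distrib)
qed

lemma binomial_sum_add: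
  fixes g :: "nat \<Rightarrow> 'a::comm_semiring_1"
  shows "(\<Sum>i\<le>k. of_nat (k choose i) * (\<Sum>j\<le>l. of_nat (l choose j) * g (i + j)))
    = (\<Sum>n\<le>k + l. of_nat (k + l choose n) * g n)"
proof (induction k arbitrary: g)
  case 0
  then show ?case by simp
next
  case (Suc k)
  show ?case
    using Suc[of g] Suc[of "\<lambda>n. g (Suc n)"] unfolding add_Suc binomial_sum_Suc by simp
qed

text \<open>The coefficients are those of \<open>(1 - (\<omega>1 X + \<omega>2 Y)) powr (- \<delta>)\<close> as a formal power series in \<open>X\<close> and
\<open>Y\<close>, so they must multiply by adding \<open>\<delta>\<close>. The computation groups the terms by \<open>i + j\<close>, which reduces it to
the Vandermonde identity for Pochhammer symbols.\<close>
lemma ml_coeff_convolution: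
  "(\<Sum>(i, j)\<in>{..k} \<times> {..l}. ml_coeff \<delta>1 \<omega>1 \<omega>2 (i, j) * ml_coeff \<delta>2 \<omega>1 \<omega>2 (k - i, l - j))
    = ml_coeff (\<delta>1 + \<delta>2) \<omega>1 \<omega>2 (k, l)"
proof -
  define g where "g n = pochhammer \<delta>1 n * pochhammer \<delta>2 (k + l - n)" for n
  let ?W = "\<omega>1 ^ k * \<omega>2 ^ l / (fact k * fact l)"
  have "ml_coeff \<delta>1 \<omega>1 \<omega>2 (i, j) * ml_coeff \<delta>2 \<omega>1 \<omega>2 (k - i, l - j)
      = ?W * (of_nat (k choose i) * (of_nat (l choose j) * g (i + j)))" if "i \<le> k" "j \<le> l" for i j
  proof -
    have "\<omega>1 ^ k = \<omega>1 ^ i * \<omega>1 ^ (k - i)" "\<omega>2 ^ l = \<omega>2 ^ j * \<omega>2 ^ (l - j)"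
      using that by (simp_all flip: power_add)
    moreover have "k - i + (l - j) = k + l - (i + j)"
      using that by simp
    ultimately show ?thesis
      using that by (simp add: ml_coeff_def g_def binomial_fact mult_ac add_ac)
  qed
  then have "(\<Sum>(i, j)\<in>{..k} \<times> {..l}. ml_coeff \<delta>1 \<omega>1 \<omega>2 (i, j) * ml_coeff \<delta>2 \<omega>1 \<omega>2 (k - i, l - j))
      = (\<Sum>(i, j)\<in>{..k} \<times> {..l}. ?W * (of_nat (k choose i) * (of_nat (l choose j) * g (i + j))))"
    by (intro sum.cong) auto
  also have "\<dots> = ?W * (\<Sum>i\<le>k. of_nat (k choose i) * (\<Sum>j\<le>l. of_nat (l choose j) * g (i + j)))"
    by (simp add: sum_distrib_left flip: sum.cartesian_product)
  also have "\<dots> = ?W * pochhammer (\<delta>1 + \<delta>2) (k + l)"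
    unfolding binomial_sum_add by (simp add: pochhammer_binomial_sum g_def mult.assoc)
  finally show ?thesis by (simp add: ml_coeff_def)
qed

lemma norm_pochhammer_le: "norm (pochhammer \<delta> n) \<le> (1 + norm \<delta>) ^ n * fact n" for \<delta> :: complex
proof (induction n)
  case (Suc n)
  have "norm (\<delta> + of_nat n) \<le> norm \<delta> + real n"
    using norm_triangle_ineq[of \<delta> "of_nat n"] by simp
  also have "\<dots> \<le> (1 + norm \<delta>) * (real n + 1)"
    by (simp add: algebra_simps)
  finally have "norm (pochhammer \<delta> n) * norm (\<delta> + of_nat n)
      \<le> ((1 + norm \<delta>) ^ n * fact n) * ((1 + norm \<delta>) * (real n + 1))"
    using Suc by (intro mult_mono) auto
  also have "\<dots> = (1 + norm \<delta>) ^ Suc n * fact (Suc n)"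
    by (simp add: mult_ac add_ac)
  finally show ?case
    by (simp only: pochhammer_Suc norm_mult)
qed simp

lemma norm_ml_coeff_le:
  "norm (ml_coeff \<delta> \<omega>1 \<omega>2 (k, l))
    \<le> (2 * (1 + norm \<delta>) * norm \<omega>1) ^ k * (2 * (1 + norm \<delta>) * norm \<omega>2) ^ l"
proof -
  have "fact (k + l) / (fact k * fact l) = (of_nat (k + l choose k) :: real)"
    by (simp add: binomial_fact)
  also have "\<dots> \<le> 2 ^ (k + l)"
    using binomial_le_pow2[of "k + l" k] by (metis of_nat_le_iff of_nat_numeral of_nat_power)
  finally have fact: "fact (k + l) / (fact k * fact l) \<le> (2 ^ (k + l) :: real)" .
  have "norm (pochhammer \<delta> (k + l) / (fact k * fact l))
      \<le> (1 + norm \<delta>) ^ (k + l) * (fact (k + l) / (fact k * fact l))"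
    using norm_pochhammer_le[of \<delta> "k + l"] by (simp add: norm_divide norm_mult divide_right_mono)
  also have "\<dots> \<le> (1 + norm \<delta>) ^ (k + l) * 2 ^ (k + l)"
    by (intro mult_left_mono fact) auto
  finally have "norm (pochhammer \<delta> (k + l) / (fact k * fact l)) * norm (\<omega>1 ^ k * \<omega>2 ^ l)
      \<le> (1 + norm \<delta>) ^ (k + l) * 2 ^ (k + l) * norm (\<omega>1 ^ k * \<omega>2 ^ l)"
    by (intro mult_right_mono) auto
  moreover have "(1 + norm \<delta>) ^ (k + l) * 2 ^ (k + l) * norm (\<omega>1 ^ k * \<omega>2 ^ l)
      = (2 * (1 + norm \<delta>) * norm \<omega>1) ^ k * (2 * (1 + norm \<delta>) * norm \<omega>2) ^ l"
    by (simp only: norm_mult norm_power power_mult_distrib power_add mult_ac)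
  ultimately show ?thesis
    by (simp only: ml_coeff_def prod.case norm_mult)
qed

lemma Re_ml_exponent_pos:
  assumes "Re \<alpha> > 0" "Re \<beta> > 0" "Re \<gamma> > 0"
  shows "Re (ml_exponent \<alpha> \<beta> \<gamma> p) > 0"
  using assms by (cases p) (simp add: ml_exponent_def add_nonneg_pos)

lemma RL_norm_ml_exponent_le:
  assumes "Re \<alpha> > 0" "Re \<beta> > 0" "Re \<gamma> > 0" "\<mu> > 0"
  shows "RL_norm \<mu> (ml_exponent \<alpha> \<beta> \<gamma> (k, l)) \<le> RL_norm \<mu> \<alpha> ^ k * RL_norm \<mu> \<beta> ^ l * RL_norm \<mu> \<gamma>"
proof (induction k)
  case 0
  show ?case
  proof (induction l)
    case (Suc l)
    have "RL_norm \<mu> (ml_exponent \<alpha> \<beta> \<gamma> (0, Suc l)) = RL_norm \<mu> (\<beta> + ml_exponent \<alpha> \<beta> \<gamma> (0, l))"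
      by (simp add: ml_exponent_def algebra_simps)
    also have "\<dots> \<le> RL_norm \<mu> \<beta> * RL_norm \<mu> (ml_exponent \<alpha> \<beta> \<gamma> (0, l))"
      using assms by (intro RL_norm_add Re_ml_exponent_pos)
    also have "\<dots> \<le> RL_norm \<mu> \<beta> * (RL_norm \<mu> \<alpha> ^ 0 * RL_norm \<mu> \<beta> ^ l * RL_norm \<mu> \<gamma>)"
      by (intro mult_left_mono Suc RL_norm_nonneg)
    finally show ?case by (simp add: mult_ac)
  qed (simp add: ml_exponent_def)
next
  case (Suc k)
  have "RL_norm \<mu> (ml_exponent \<alpha> \<beta> \<gamma> (Suc k, l)) = RL_norm \<mu> (\<alpha> + ml_exponent \<alpha> \<beta> \<gamma> (k, l))"
    by (simp add: ml_exponent_def algebra_simps)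
  also have "\<dots> \<le> RL_norm \<mu> \<alpha> * RL_norm \<mu> (ml_exponent \<alpha> \<beta> \<gamma> (k, l))"
    using assms by (intro RL_norm_add Re_ml_exponent_pos)
  also have "\<dots> \<le> RL_norm \<mu> \<alpha> * (RL_norm \<mu> \<alpha> ^ k * RL_norm \<mu> \<beta> ^ l * RL_norm \<mu> \<gamma>)"
    by (intro mult_left_mono Suc RL_norm_nonneg)
  finally show ?case by (simp add: mult_ac)
qed

text \<open>The coefficients and the norms both grow at most geometrically in \<open>k\<close> and \<open>l\<close>. The ratios contain the
factors \<open>RL_norm \<mu> \<alpha>\<close> and \<open>RL_norm \<mu> \<beta>\<close>, which become arbitrarily small as the damping rate \<open>\<mu>\<close> grows.
Stating this for all large \<open>\<mu>\<close> lets several kernels share one rate.\<close>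
lemma eventually_RL_summable_ml:
  assumes "Re \<alpha> > 0" "Re \<beta> > 0" "Re \<gamma> > 0"
  shows "eventually (\<lambda>\<mu>. RL_summable \<mu> (ml_coeff \<delta> \<omega>1 \<omega>2) (ml_exponent \<alpha> \<beta> \<gamma>)) at_top"
proof -
  define X where "X = 2 * (1 + norm \<delta>) * norm \<omega>1"
  define Y where "Y = 2 * (1 + norm \<delta>) * norm \<omega>2"
  have XY: "X \<ge> 0" "Y \<ge> 0" by (auto simp: X_def Y_def)
  have lim: "((\<lambda>\<mu>. X * RL_norm \<mu> \<alpha>) \<longlongrightarrow> X * 0) at_top" "((\<lambda>\<mu>. Y * RL_norm \<mu> \<beta>) \<longlongrightarrow> Y * 0) at_top"
    by (intro tendsto_mult tendsto_const RL_norm_tendsto_0 assms)+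
  have "eventually (\<lambda>\<mu>. X * RL_norm \<mu> \<alpha> < 1) at_top" "eventually (\<lambda>\<mu>. Y * RL_norm \<mu> \<beta> < 1) at_top"
    using order_tendstoD(2)[OF lim(1), of 1] order_tendstoD(2)[OF lim(2), of 1] by auto
  then show ?thesis
    using eventually_gt_at_top[of 0]
  proof eventually_elim
    case (elim \<mu>)
    have geo: "(\<lambda>k. (X * RL_norm \<mu> \<alpha>) ^ k) abs_summable_on UNIV"
      "(\<lambda>l. (Y * RL_norm \<mu> \<beta>) ^ l) abs_summable_on UNIV"
      using elim XY by (auto simp: abs_summable_on_nat_iff' RL_norm_nonneg summable_geometric)
    have "(\<lambda>p. norm (ml_coeff \<delta> \<omega>1 \<omega>2 p) * RL_norm \<mu> (ml_exponent \<alpha> \<beta> \<gamma> p)) abs_summable_on UNIV \<times> UNIV"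
    proof (rule abs_summable_on_comparison_test')
      show "(\<lambda>(k, l). RL_norm \<mu> \<gamma> * ((X * RL_norm \<mu> \<alpha>) ^ k * (Y * RL_norm \<mu> \<beta>) ^ l))
          abs_summable_on UNIV \<times> UNIV"
        using abs_summable_on_cmult_right[OF abs_summable_on_product[OF _ _ geo], of "RL_norm \<mu> \<gamma>"]
        by (simp add: case_prod_unfold)
    next
      fix p :: "nat \<times> nat"
      obtain k l where p: "p = (k, l)" by fastforce
      have "norm (ml_coeff \<delta> \<omega>1 \<omega>2 p) * RL_norm \<mu> (ml_exponent \<alpha> \<beta> \<gamma> p)
          \<le> (X ^ k * Y ^ l) * (RL_norm \<mu> \<alpha> ^ k * RL_norm \<mu> \<beta> ^ l * RL_norm \<mu> \<gamma>)"
        unfolding p using norm_ml_coeff_le[of \<delta> \<omega>1 \<omega>2 k l] XY elim assms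
        by (intro mult_mono RL_norm_ml_exponent_le) (auto simp: X_def Y_def RL_norm_nonneg)
      then show "norm (norm (ml_coeff \<delta> \<omega>1 \<omega>2 p) * RL_norm \<mu> (ml_exponent \<alpha> \<beta> \<gamma> p))
          \<le> (case p of (k, l) \<Rightarrow> RL_norm \<mu> \<gamma> * ((X * RL_norm \<mu> \<alpha>) ^ k * (Y * RL_norm \<mu> \<beta>) ^ l))"
        by (simp add: p RL_norm_nonneg power_mult_distrib mult_ac)
    qed
    then show ?case
      using elim by (simp add: RL_summable_def Re_ml_exponent_pos assms)
  qed
qed

abbreviation ml_kernel :: "complex \<Rightarrow> complex \<Rightarrow> complex \<Rightarrow> complex \<Rightarrow> complex \<Rightarrow> complex \<Rightarrow> real \<Rightarrow> complex" where
  "ml_kernel \<alpha> \<beta> \<gamma> \<delta> \<omega>1 \<omega>2 \<equiv> RL_series (ml_coeff \<delta> \<omega>1 \<omega>2) (ml_exponent \<alpha> \<beta> \<gamma>)"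

text \<open>Terms with the same total index \<open>p + q\<close> have the same exponent, so the double series is regrouped by this
index and each finite block is summed by \<open>ml_coeff_convolution\<close>.\<close>
lemma RL_series_ml_product:
  assumes "RL_summable \<mu> (ml_coeff \<delta>1 \<omega>1 \<omega>2) (ml_exponent \<alpha> \<beta> \<gamma>1)"
    and "RL_summable \<mu> (ml_coeff \<delta>2 \<omega>1 \<omega>2) (ml_exponent \<alpha> \<beta> \<gamma>2)"
  shows "RL_series (\<lambda>(p, q). ml_coeff \<delta>1 \<omega>1 \<omega>2 p * ml_coeff \<delta>2 \<omega>1 \<omega>2 q)
           (\<lambda>(p, q). ml_exponent \<alpha> \<beta> \<gamma>1 p + ml_exponent \<alpha> \<beta> \<gamma>2 q)
         = ml_kernel \<alpha> \<beta> (\<gamma>1 + \<gamma>2) (\<delta>1 + \<delta>2) \<omega>1 \<omega>2"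
proof
  fix t
  define F where "F = (\<lambda>(p, q). ml_coeff \<delta>1 \<omega>1 \<omega>2 p * ml_coeff \<delta>2 \<omega>1 \<omega>2 q
    * RL_kernel (ml_exponent \<alpha> \<beta> \<gamma>1 p + ml_exponent \<alpha> \<beta> \<gamma>2 q) t)"
  \<comment> \<open>\<open>h\<close> sends a total index \<open>(k, l)\<close> and a first summand \<open>(i, j)\<close> below it to the two summands.\<close>
  define B :: "nat \<times> nat \<Rightarrow> (nat \<times> nat) set" where "B = (\<lambda>(k, l). {..k} \<times> {..l})"
  define h :: "(nat \<times> nat) \<times> (nat \<times> nat) \<Rightarrow> _"
    where "h = (\<lambda>((k, l), (i, j)). ((i, j), (k - i, l - j)))"
  have bij: "bij_betw h (Sigma UNIV B) UNIV"
    by (rule bij_betwI[of _ _ _ "\<lambda>((i, j), (k, l)). ((i + k, j + l), (i, j))"]) (auto simp: h_def B_def)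
  have "F abs_summable_on UNIV"
    using RL_series_abs_summable[OF RL_summable_product[OF assms], of t] by (simp add: F_def case_prod_unfold)
  then have summable: "(\<lambda>x. F (h x)) abs_summable_on Sigma UNIV B"
    by (subst abs_summable_on_reindex_bij_betw[OF bij])
  have inner: "(\<Sum>\<^sub>aq\<in>B r. F (h (r, q)))
      = ml_coeff (\<delta>1 + \<delta>2) \<omega>1 \<omega>2 r * RL_kernel (ml_exponent \<alpha> \<beta> (\<gamma>1 + \<gamma>2) r) t" for r
  proof -
    obtain k l where r: "r = (k, l)" by fastforce
    have "ml_exponent \<alpha> \<beta> \<gamma>1 (i, j) + ml_exponent \<alpha> \<beta> \<gamma>2 (k - i, l - j) = ml_exponent \<alpha> \<beta> (\<gamma>1 + \<gamma>2) (k, l)"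
      if "i \<le> k" "j \<le> l" for i j
      using that by (simp add: ml_exponent_def algebra_simps of_nat_diff)
    then have "(\<Sum>\<^sub>aq\<in>B r. F (h (r, q))) = (\<Sum>(i, j)\<in>{..k} \<times> {..l}.
        ml_coeff \<delta>1 \<omega>1 \<omega>2 (i, j) * ml_coeff \<delta>2 \<omega>1 \<omega>2 (k - i, l - j)
        * RL_kernel (ml_exponent \<alpha> \<beta> (\<gamma>1 + \<gamma>2) (k, l)) t)"
      by (simp add: r B_def) (intro sum.cong, auto simp: F_def h_def)
    then show ?thesis
      by (simp add: r ml_coeff_convolution[symmetric] sum_distrib_right case_prod_unfold)
  qed
  have "infsetsum F UNIV = (\<Sum>\<^sub>ax\<in>Sigma UNIV B. F (h x))"
    by (rule infsetsum_reindex_bij_betw[OF bij, symmetric])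
  also have "\<dots> = (\<Sum>\<^sub>ar. \<Sum>\<^sub>aq\<in>B r. F (h (r, q)))"
    by (rule infsetsum_Sigma[OF _ _ summable]) auto
  finally show "RL_series (\<lambda>(p, q). ml_coeff \<delta>1 \<omega>1 \<omega>2 p * ml_coeff \<delta>2 \<omega>1 \<omega>2 q)
      (\<lambda>(p, q). ml_exponent \<alpha> \<beta> \<gamma>1 p + ml_exponent \<alpha> \<beta> \<gamma>2 q) t
    = ml_kernel \<alpha> \<beta> (\<gamma>1 + \<gamma>2) (\<delta>1 + \<delta>2) \<omega>1 \<omega>2 t"
    unfolding inner by (simp add: RL_series_def F_def case_prod_unfold)
qed

lemma powr_of_real_power: "t > 0 \<Longrightarrow> (complex_of_real t powr a) ^ n = of_real t powr (a * of_nat n)"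
  by (simp add: powr_def mult_ac flip: exp_of_nat_mult)

lemma mittag_leffler2_eq_ml_kernel:
  assumes S: "RL_summable \<mu> (ml_coeff \<delta> \<omega>1 \<omega>2) (ml_exponent \<alpha> \<beta> \<gamma>)" and t: "t > 0"
  shows "complex_of_real t powr (\<gamma> - 1)
      * mittag_leffler2 \<alpha> \<beta> \<gamma> \<delta> (\<omega>1 * complex_of_real t powr \<alpha>) (\<omega>2 * complex_of_real t powr \<beta>)
    = ml_kernel \<alpha> \<beta> \<gamma> \<delta> \<omega>1 \<omega>2 t"
proof -
  define u where "u = complex_of_real t powr (\<gamma> - 1)"
  have u: "u \<noteq> 0" using t by (simp add: u_def)
  define T where "T k l = pochhammer \<delta> (k + l) / Gamma (\<alpha> * of_nat k + \<beta> * of_nat l + \<gamma>)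
      * ((\<omega>1 * complex_of_real t powr \<alpha>) ^ k * (\<omega>2 * complex_of_real t powr \<beta>) ^ l / (fact k * fact l))" for k l
  let ?f = "\<lambda>p. ml_coeff \<delta> \<omega>1 \<omega>2 p * RL_kernel (ml_exponent \<alpha> \<beta> \<gamma> p) t"
  have uT: "u * T k l = ?f (k, l)" for k l
  proof -
    have "complex_of_real t powr (ml_exponent \<alpha> \<beta> \<gamma> (k, l) - 1)
        = u * (complex_of_real t powr \<alpha>) ^ k * (complex_of_real t powr \<beta>) ^ l"
      using t by (simp add: u_def ml_exponent_def powr_of_real_power flip: powr_add)
        (simp add: algebra_simps)
    then show ?thesis
      using t by (simp add: T_def RL_kernel_def ml_coeff_def power_mult_distrib)
        (simp add: ml_exponent_def mult_ac)
  qed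
  have f: "?f abs_summable_on UNIV \<times> UNIV"
    using RL_series_abs_summable[OF S] by simp
  have "T k l = inverse u * ?f (k, l)" for k l
    using u by (simp flip: uT)
  then have "(\<lambda>(k, l). T k l) abs_summable_on UNIV \<times> UNIV"
    using abs_summable_on_cmult_right[OF f, of "inverse u"] by (simp add: case_prod_unfold)
  note T = this
  have "mittag_leffler2 \<alpha> \<beta> \<gamma> \<delta> (\<omega>1 * complex_of_real t powr \<alpha>) (\<omega>2 * complex_of_real t powr \<beta>) = (\<Sum>k. \<Sum>l. T k l)"
    by (simp add: mittag_leffler2_def T_def)
  also have "\<dots> = (\<Sum>k. \<Sum>\<^sub>al. T k l)"
    using abs_summable_on_Sigma_project2[OF T] by (simp add: infsetsum_nat')
  also have "\<dots> = (\<Sum>\<^sub>ak. \<Sum>\<^sub>al. T k l)"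
    by (rule infsetsum_nat'[symmetric]) (rule abs_summable_on_Sigma_project1'[OF T]; simp)
  also have "\<dots> = (\<Sum>\<^sub>a(k, l)\<in>UNIV \<times> UNIV. T k l)"
    by (rule infsetsum_Times'[OF _ _ T]) auto
  also have "u * \<dots> = (\<Sum>\<^sub>a(k, l)\<in>UNIV \<times> UNIV. u * T k l)"
    using T by (subst infsetsum_cmult_right[symmetric]) (auto simp: case_prod_unfold)
  also have "\<dots> = infsetsum ?f UNIV"
    by (simp add: uT case_prod_unfold)
  finally show ?thesis
    by (simp add: u_def RL_series_def)
qed

lemma mittag_leffler2_zero: "mittag_leffler2 \<alpha> \<beta> \<gamma> 0 x y = 1 / Gamma \<gamma>"
proof -
  let ?T = "\<lambda>k l. pochhammer 0 (k + l) / Gamma (\<alpha> * of_nat k + \<beta> * of_nat l + \<gamma>)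
    * (x ^ k * y ^ l / (fact k * fact l))"
  have "(\<Sum>l. ?T k l) = (if k = 0 then 1 / Gamma \<gamma> else 0)" for k
  proof -
    have "(\<Sum>l. ?T k l) = (\<Sum>l\<in>{0}. ?T k l)"
      by (rule suminf_finite) (auto simp: pochhammer_0_left)
    then show ?thesis by (simp add: pochhammer_0_left)
  qed
  then have "mittag_leffler2 \<alpha> \<beta> \<gamma> 0 x y = (\<Sum>k. if k = 0 then 1 / Gamma \<gamma> else 0)"
    by (simp add: mittag_leffler2_def)
  also have "\<dots> = (\<Sum>k\<in>{0}. if k = 0 then 1 / Gamma \<gamma> else 0)"
    by (subst suminf_finite[of "{0}"]) auto
  finally show ?thesis by simp
qed

section \<open>The integral operators\<close>

lemma measurable_RL_series:
  fixes c z :: "'i::countable \<Rightarrow> complex"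
  assumes "RL_summable \<mu> c z"
  shows "RL_series c z \<in> borel_measurable borel"
proof -
  have "RL_series c z = damp (- \<mu>) (damp \<mu> (RL_series c z))"
    by (simp add: damp_def fun_eq_iff flip: mult.assoc of_real_mult exp_add)
  moreover have "damp \<mu> (RL_series c z) \<in> borel_measurable borel"
    using integrable_damp_RL_series[OF assms] by auto
  ultimately show ?thesis
    by (metis measurable_damp)
qed

lemma integrable_lebesgue_borel_version:
  fixes f :: "real \<Rightarrow> complex"
  assumes f: "integrable lebesgue f"
  obtains f' where "integrable lborel f'" "AE x in lebesgue. f x = f' x"
proof -
  have "(\<lambda>x. Re (f x)) \<in> borel_measurable lebesgue" "(\<lambda>x. Im (f x)) \<in> borel_measurable lebesgue"
    using f by auto
  from this[THEN completion_ex_borel_measurable_real]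
  obtain u v where [measurable]: "u \<in> borel_measurable lborel" "v \<in> borel_measurable lborel"
    and uv: "AE x in lborel. Re (f x) = u x" "AE x in lborel. Im (f x) = v x" by blast
  define f' where "f' x = Complex (u x) (v x)" for x
  have f'_alt: "f' = (\<lambda>x. of_real (u x) + \<i> * of_real (v x))"
    by (simp add: f'_def fun_eq_iff complex_eq_iff)
  have [measurable]: "f' \<in> borel_measurable lborel" unfolding f'_alt by simp
  have "AE x in lborel. f x = f' x"
    using uv by eventually_elim (simp add: f'_def complex_eq_iff)
  then have ae: "AE x in lebesgue. f x = f' x" by (rule AE_completion)
  then have "integrable lebesgue f'"
    using f by (subst integrable_cong_AE[of _ _ f]) (auto intro: measurable_completion)
  then have "integrable lborel f'" by (simp add: integrable_completion)
  with ae show ?thesis by (intro that)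
qed

text \<open>The operator is a convolution on the whole line, because the kernel vanishes on the negative half-line
and \<open>g\<close> vanishes to the left of \<open>c\<close>; the exponential factors undo the damping. The function \<open>F\<close> is only
compared with \<open>g\<close> on \<open>(c, x)\<close>, up to null sets, so that the lemma covers both a Lebesgue measurable
function and the values of another operator, which are known on the interval only.\<close>
lemma ml_integral_eq_conv:
  assumes S: "RL_summable \<mu> (ml_coeff \<delta> \<omega>1 \<omega>2) (ml_exponent \<alpha> \<beta> \<gamma>)"
    and [measurable]: "g \<in> borel_measurable borel"
    and g0: "\<And>\<xi>. \<xi> \<le> c \<Longrightarrow> g \<xi> = 0"
    and F: "(\<lambda>\<xi>. indicator {c<..<x} \<xi> *\<^sub>R F \<xi>) \<in> borel_measurable lebesgue"
    and Fg: "AE \<xi> in lebesgue. \<xi> \<in> {c<..<x} \<longrightarrow> F \<xi> = of_real (exp (\<mu> * \<xi>)) * g \<xi>"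
  shows "ml_integral c \<alpha> \<beta> \<gamma> \<delta> \<omega>1 \<omega>2 F x
    = of_real (exp (\<mu> * x)) * conv (damp \<mu> (ml_kernel \<alpha> \<beta> \<gamma> \<delta> \<omega>1 \<omega>2)) g x"
proof -
  let ?K = "ml_kernel \<alpha> \<beta> \<gamma> \<delta> \<omega>1 \<omega>2"
  have K[measurable]: "?K \<in> borel_measurable borel" by (rule measurable_RL_series[OF S])
  have "ml_integral c \<alpha> \<beta> \<gamma> \<delta> \<omega>1 \<omega>2 F x
      = (LINT \<xi>|lebesgue. ?K (x - \<xi>) * (indicator {c<..<x} \<xi> *\<^sub>R F \<xi>))"
    unfolding ml_integral_def set_lebesgue_integral_def
    by (intro Bochner_Integration.integral_cong refl)
       (auto simp: indicator_def mittag_leffler2_eq_ml_kernel[OF S] simp del: of_real_diff)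
  also have "\<dots> = (LINT \<xi>|lebesgue. of_real (exp (\<mu> * x)) * (damp \<mu> ?K (x - \<xi>) * g \<xi>))"
  proof (rule integral_cong_AE)
    have "(\<lambda>\<xi>. ?K (x - \<xi>)) \<in> borel_measurable lebesgue"
      by (intro measurable_completion) measurable
    then show "(\<lambda>\<xi>. ?K (x - \<xi>) * (indicator {c<..<x} \<xi> *\<^sub>R F \<xi>)) \<in> borel_measurable lebesgue"
      using F by (rule borel_measurable_times)
    show "(\<lambda>\<xi>. of_real (exp (\<mu> * x)) * (damp \<mu> ?K (x - \<xi>) * g \<xi>)) \<in> borel_measurable lebesgue"
      by (intro measurable_completion) measurable
    show "AE \<xi> in lebesgue. ?K (x - \<xi>) * (indicator {c<..<x} \<xi> *\<^sub>R F \<xi>)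
        = of_real (exp (\<mu> * x)) * (damp \<mu> ?K (x - \<xi>) * g \<xi>)"
      using Fg
    proof eventually_elim
      case (elim \<xi>)
      show ?case
      proof (cases "\<xi> \<in> {c<..<x}")
        case True
        have "exp (\<mu> * \<xi>) = exp (\<mu> * x) * exp (- \<mu> * (x - \<xi>))"
          by (simp add: algebra_simps flip: exp_add)
        then show ?thesis using True elim by (simp add: damp_def)
      next
        case False
        then show ?thesis using g0[of \<xi>] by (auto simp: damp_def RL_series_nonpos)
      qed
    qed
  qed
  also have "\<dots> = (LINT \<xi>|lborel. of_real (exp (\<mu> * x)) * (damp \<mu> ?K (x - \<xi>) * g \<xi>))"
    by (rule integral_completion) measurable
  finally show ?thesis by (simp add: conv_def)
qed

text \<open>One damping rate is chosen for the three kernels. After passing to a Borel version of the integrand,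
damped and cut off outside \<open>(c, d)\<close>, the two sides are \<open>K1 * (K2 * g)\<close> and \<open>K12 * g\<close>, with \<open>*\<close> the
convolution and \<open>K12 = K1 * K2\<close> almost everywhere.\<close>
lemma ml_integral_semigroup:
  assumes \<alpha>: "Re \<alpha> > 0" and \<beta>: "Re \<beta> > 0" and \<gamma>: "Re \<gamma>1 > 0" "Re \<gamma>2 > 0"
    and f: "set_integrable lebesgue {c<..<d} f"
  shows "AE x\<in>{c<..<d} in lebesgue.
    ml_integral c \<alpha> \<beta> \<gamma>1 \<delta>1 \<omega>1 \<omega>2 (ml_integral c \<alpha> \<beta> \<gamma>2 \<delta>2 \<omega>1 \<omega>2 f) x
      = ml_integral c \<alpha> \<beta> (\<gamma>1 + \<gamma>2) (\<delta>1 + \<delta>2) \<omega>1 \<omega>2 f x"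
proof -
  have "Re (\<gamma>1 + \<gamma>2) > 0" using \<gamma> by simp
  from eventually_conj[OF eventually_RL_summable_ml[OF \<alpha> \<beta> \<gamma>(1), of \<delta>1 \<omega>1 \<omega>2]
      eventually_conj[OF eventually_RL_summable_ml[OF \<alpha> \<beta> \<gamma>(2), of \<delta>2 \<omega>1 \<omega>2]
      eventually_RL_summable_ml[OF \<alpha> \<beta> this, of "\<delta>1 + \<delta>2" \<omega>1 \<omega>2]]]
  obtain \<mu> where S1: "RL_summable \<mu> (ml_coeff \<delta>1 \<omega>1 \<omega>2) (ml_exponent \<alpha> \<beta> \<gamma>1)"
    and S2: "RL_summable \<mu> (ml_coeff \<delta>2 \<omega>1 \<omega>2) (ml_exponent \<alpha> \<beta> \<gamma>2)"
    and S12: "RL_summable \<mu> (ml_coeff (\<delta>1 + \<delta>2) \<omega>1 \<omega>2) (ml_exponent \<alpha> \<beta> (\<gamma>1 + \<gamma>2))"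
    by (auto dest: eventually_happens)
  then have \<mu>: "\<mu> > 0" by (simp add: RL_summable_def)
  define K1 where "K1 = damp \<mu> (ml_kernel \<alpha> \<beta> \<gamma>1 \<delta>1 \<omega>1 \<omega>2)"
  define K2 where "K2 = damp \<mu> (ml_kernel \<alpha> \<beta> \<gamma>2 \<delta>2 \<omega>1 \<omega>2)"
  define K12 where "K12 = damp \<mu> (ml_kernel \<alpha> \<beta> (\<gamma>1 + \<gamma>2) (\<delta>1 + \<delta>2) \<omega>1 \<omega>2)"
  have K: "integrable lborel K1" "integrable lborel K2" "integrable lborel K12"
    unfolding K1_def K2_def K12_def by (intro integrable_damp_RL_series S1 S2 S12)+
  have K2_nonpos: "K2 t = 0" if "t \<le> 0" for t
    using that by (simp add: K2_def damp_def RL_series_nonpos)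

  obtain f' where f': "integrable lborel f'"
    and ff': "AE x in lebesgue. indicator {c<..<d} x *\<^sub>R f x = f' x"
    using integrable_lebesgue_borel_version f[unfolded set_integrable_def] by blast
  \<comment> \<open>The cut-off bounds the factor \<open>exp (- \<mu> * \<xi>)\<close> by its value at \<open>c\<close>.\<close>
  define g where "g \<xi> = indicator {c<..<d} \<xi> *\<^sub>R (of_real (exp (- \<mu> * \<xi>)) * f' \<xi>)" for \<xi>
  have [measurable]: "f' \<in> borel_measurable borel" using f' by auto
  have g: "integrable lborel g"
  proof (rule Bochner_Integration.integrable_bound)
    show "integrable lborel (\<lambda>\<xi>. exp (- \<mu> * c) * norm (f' \<xi>))"
      using f' by simp
    show "g \<in> borel_measurable lborel" unfolding g_def[abs_def] by measurable
    have "norm (g \<xi>) \<le> norm (exp (- \<mu> * c) * norm (f' \<xi>))" for \<xi>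
      using \<mu> by (auto simp: g_def indicator_def norm_mult intro!: mult_right_mono)
    then show "AE \<xi> in lborel. norm (g \<xi>) \<le> norm (exp (- \<mu> * c) * norm (f' \<xi>))" by simp
  qed
  then have g_meas: "g \<in> borel_measurable borel" by auto
  have g0: "g \<xi> = 0" if "\<xi> \<le> c" for \<xi> using that by (simp add: g_def)
  have meas: "(\<lambda>\<xi>. indicator {c<..<x} \<xi> *\<^sub>R f \<xi>) \<in> borel_measurable lebesgue"
    and fg: "AE \<xi> in lebesgue. \<xi> \<in> {c<..<x} \<longrightarrow> f \<xi> = of_real (exp (\<mu> * \<xi>)) * g \<xi>"
    if x: "x \<in> {c<..<d}" for x
  proof -
    have "(indicator {c<..<x} :: real \<Rightarrow> real) \<in> borel_measurable lebesgue"
      by (intro measurable_completion) measurable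
    moreover have "(\<lambda>\<xi>. indicator {c<..<d} \<xi> *\<^sub>R f \<xi>) \<in> borel_measurable lebesgue"
      using f unfolding set_integrable_def by auto
    ultimately have "(\<lambda>\<xi>. indicat_real {c<..<x} \<xi> *\<^sub>R (indicat_real {c<..<d} \<xi> *\<^sub>R f \<xi>)) \<in> borel_measurable lebesgue"
      by (rule borel_measurable_scaleR)
    moreover have "indicat_real {c<..<x} \<xi> *\<^sub>R (indicat_real {c<..<d} \<xi> *\<^sub>R f \<xi>) = indicator {c<..<x} \<xi> *\<^sub>R f \<xi>" for \<xi>
      using x by (auto simp: indicator_def)
    ultimately show "(\<lambda>\<xi>. indicator {c<..<x} \<xi> *\<^sub>R f \<xi>) \<in> borel_measurable lebesgue" by (simp only:)
    show "AE \<xi> in lebesgue. \<xi> \<in> {c<..<x} \<longrightarrow> f \<xi> = of_real (exp (\<mu> * \<xi>)) * g \<xi>"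
      using ff'
      by eventually_elim
        (use x in \<open>auto simp: g_def simp flip: mult.assoc of_real_mult exp_add\<close>)
  qed
  have inner: "ml_integral c \<alpha> \<beta> \<gamma>2 \<delta>2 \<omega>1 \<omega>2 f x = of_real (exp (\<mu> * x)) * conv K2 g x"
    and total: "ml_integral c \<alpha> \<beta> (\<gamma>1 + \<gamma>2) (\<delta>1 + \<delta>2) \<omega>1 \<omega>2 f x = of_real (exp (\<mu> * x)) * conv K12 g x"
    if "x \<in> {c<..<d}" for x
    unfolding K2_def K12_def
    by (intro ml_integral_eq_conv S2 S12 g_meas g0 meas fg that; assumption)+
  have conv_meas: "conv K2 g \<in> borel_measurable borel"
    using conv_integrable[OF K(2) g] by auto
  have conv0: "conv K2 g \<xi> = 0" if "\<xi> \<le> c" for \<xi>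
  proof -
    have "K2 (\<xi> - y) * g y = 0" for y
      using that g0[of y] K2_nonpos[of "\<xi> - y"] by (cases "y \<le> c") auto
    then show ?thesis by (simp only: conv_def) simp
  qed
  have outer: "ml_integral c \<alpha> \<beta> \<gamma>1 \<delta>1 \<omega>1 \<omega>2 (ml_integral c \<alpha> \<beta> \<gamma>2 \<delta>2 \<omega>1 \<omega>2 f) x
      = of_real (exp (\<mu> * x)) * conv K1 (conv K2 g) x" if x: "x \<in> {c<..<d}" for x
    unfolding K1_def
  proof (rule ml_integral_eq_conv[OF S1 conv_meas conv0])
    have "indicator {c<..<x} \<xi> *\<^sub>R ml_integral c \<alpha> \<beta> \<gamma>2 \<delta>2 \<omega>1 \<omega>2 f \<xi>
        = indicator {c<..<x} \<xi> *\<^sub>R (of_real (exp (\<mu> * \<xi>)) * conv K2 g \<xi>)" for \<xi>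
      using x inner[of \<xi>] by (auto simp: indicator_def)
    moreover have "(\<lambda>\<xi>. indicat_real {c<..<x} \<xi> *\<^sub>R (of_real (exp (\<mu> * \<xi>)) * conv K2 g \<xi>))
        \<in> borel_measurable lebesgue"
      using conv_meas by (intro measurable_completion) measurable
    ultimately show "(\<lambda>\<xi>. indicator {c<..<x} \<xi> *\<^sub>R ml_integral c \<alpha> \<beta> \<gamma>2 \<delta>2 \<omega>1 \<omega>2 f \<xi>)
        \<in> borel_measurable lebesgue" by (simp only:)
    show "AE \<xi> in lebesgue. \<xi> \<in> {c<..<x} \<longrightarrow>
        ml_integral c \<alpha> \<beta> \<gamma>2 \<delta>2 \<omega>1 \<omega>2 f \<xi> = of_real (exp (\<mu> * \<xi>)) * conv K2 g \<xi>"
      using x inner by auto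
  qed
  have "AE t in lborel. conv K1 K2 t = K12 t"
    using conv_RL_series_AE[OF S1 S2] unfolding RL_series_ml_product[OF S1 S2] K1_def K2_def K12_def .
  then have "conv (conv K1 K2) g x = conv K12 g x" for x
    using conv_integrable[OF K(1,2)] K(3) g_meas by (intro conv_AE_cong) auto
  then have "AE x in lborel. conv K1 (conv K2 g) x = conv K12 g x"
    using conv_assoc_AE[OF K(1,2) g] by simp
  then have "AE x in lebesgue. conv K1 (conv K2 g) x = conv K12 g x"
    by (rule AE_completion)
  then show ?thesis
    by eventually_elim (simp add: outer total)
qed

lemma ml_integral_zero: "ml_integral c \<alpha> \<beta> \<gamma> 0 \<omega>1 \<omega>2 f x = RL_integral c \<gamma> f x"
proof -
  let ?p = "\<lambda>\<xi>. complex_of_real (x - \<xi>) powr (\<gamma> - 1)"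
  have "indicator {c<..<x} \<xi> *\<^sub>R (?p \<xi> * (1 / Gamma \<gamma>) * f \<xi>)
      = 1 / Gamma \<gamma> * (indicator {c<..<x} \<xi> *\<^sub>R (?p \<xi> * f \<xi>))" for \<xi>
    by simp
  then show ?thesis
    unfolding ml_integral_def RL_integral_def set_lebesgue_integral_def mittag_leffler2_zero
    by (simp only: integral_mult_right_zero)
qed

theorem theorem3p6:
  fixes c d :: real
    and \<alpha> \<beta> \<gamma>1 \<gamma>2 \<delta>1 \<delta>2 \<omega>1 \<omega>2 :: complex
    and f :: "real \<Rightarrow> complex"
  assumes "c < d"
    and "Re \<alpha> > 0" and "Re \<beta> > 0" and "Re \<gamma>1 > 0" and "Re \<gamma>2 > 0"
    and "set_integrable lebesgue {c<..<d} f"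
  shows "(AE x\<in>{c<..<d} in lebesgue.
            ml_integral c \<alpha> \<beta> \<gamma>1 \<delta>1 \<omega>1 \<omega>2 (ml_integral c \<alpha> \<beta> \<gamma>2 \<delta>2 \<omega>1 \<omega>2 f) x
              = ml_integral c \<alpha> \<beta> (\<gamma>1 + \<gamma>2) (\<delta>1 + \<delta>2) \<omega>1 \<omega>2 f x)
       \<and> (\<forall>\<delta>::complex. AE x\<in>{c<..<d} in lebesgue.
            ml_integral c \<alpha> \<beta> \<gamma>1 \<delta> \<omega>1 \<omega>2 (ml_integral c \<alpha> \<beta> \<gamma>2 (- \<delta>) \<omega>1 \<omega>2 f) x
              = RL_integral c (\<gamma>1 + \<gamma>2) f x)"
proof (intro conjI allI)
  show "AE x\<in>{c<..<d} in lebesgue.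
      ml_integral c \<alpha> \<beta> \<gamma>1 \<delta>1 \<omega>1 \<omega>2 (ml_integral c \<alpha> \<beta> \<gamma>2 \<delta>2 \<omega>1 \<omega>2 f) x
        = ml_integral c \<alpha> \<beta> (\<gamma>1 + \<gamma>2) (\<delta>1 + \<delta>2) \<omega>1 \<omega>2 f x"
    by (rule ml_integral_semigroup) fact+
  fix \<delta>
  have "AE x\<in>{c<..<d} in lebesgue.
      ml_integral c \<alpha> \<beta> \<gamma>1 \<delta> \<omega>1 \<omega>2 (ml_integral c \<alpha> \<beta> \<gamma>2 (- \<delta>) \<omega>1 \<omega>2 f) x
        = ml_integral c \<alpha> \<beta> (\<gamma>1 + \<gamma>2) (\<delta> + - \<delta>) \<omega>1 \<omega>2 f x"
    by (rule ml_integral_semigroup) fact+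
  then show "AE x\<in>{c<..<d} in lebesgue.
      ml_integral c \<alpha> \<beta> \<gamma>1 \<delta> \<omega>1 \<omega>2 (ml_integral c \<alpha> \<beta> \<gamma>2 (- \<delta>) \<omega>1 \<omega>2 f) x
        = RL_integral c (\<gamma>1 + \<gamma>2) f x"
    by (simp add: ml_integral_zero)
qed

end
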